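(* Let $\mathcal{V}=\{1,\dots,n_y\}$ be the finite set of available sensing nodes, and for $\mathcal{S}\subseteq\mathcal{V}$ let $V_o(\mathcal{S})\in\mathbb{R}^{n_x\times n_x}$ be the parameterized variational observability Gramian, around an initial state $x_0\in\mathcal{X}_0$ and over the observation horizon $\mathrm{N}\ge 1$, of the discrete-time nonlinear system $x_{k+1}=x_k+\tilde f(x_k)$, $y_k=\tilde C x_k$. Then the set function $f:2^{\mathcal{V}}\to\mathbb{R}$ defined by $$f(\mathcal{S})=\operatorname{trace}\left(V_o(\mathcal{S})\right),\qquad \mathcal{S}\subseteq\mathcal{V},$$ is modular.
   Context: System. $\mathcal{M}\subseteq\mathbb{R}^{n_x}$ is the (open) state space, and $\tilde f:\mathcal{M}\to\mathbb{R}^{n_x}$ is smooth (at least twice continuously differentiable). The system is $x_{k+1}=x_k+\tilde f(x_k)$, $y_k=\tilde C x_k$, $k=0,1,2,\dots$, with $x_k\in\mathbb{R}^{n_x}$, $y_k\in\mathbb{R}^{n_y}$. Standing assumption: there is a compact set $\mathcal{X}\subseteq\mathcal{M}$ such that the trajectory remains in $\mathcal{X}$ for every initial state $x_0\in\mathcal{X}_0$ and every $k\ge 0$, where $\mathcal{X}_0\subseteq\mathcal{X}$ is the set of initial states. Sensor parameterization. Sensor $j\in\mathcal{V}$ has a measurement row $c_j\in\mathbb{R}^{1\times n_x}$. For $\mathcal{S}\subseteq\mathcal{V}$, $\tilde C=\tilde C(\mathcal{S})\in\mathbb{R}^{n_y\times n_x}$ is the matrix whose $j$-th row is $c_j$ if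 $j\in\mathcal{S}$ (sensor selected) and $0$ otherwise. Variational mapping. For the trajectory from $x_0$, $\Phi_0^k\in\mathbb{R}^{n_x\times n_x}$ is the Jacobian $\partial x_k/\partial x_0$; thus $\Phi_0^0=I_{n_x}$ and, by the chain rule, $\Phi_0^k=\Phi_{k-1}^k\Phi_{k-2}^{k-1}\cdots\Phi_0^1$ with $\Phi_{i-1}^{i}=I_{n_x}+\frac{\partial\tilde f}{\partial x}(x_{i-1})$. Gramian. $\Psi_0^k:=\tilde C(\mathcal{S})\Phi_0^k$, and $\Psi\in\mathbb{R}^{\mathrm{N}n_y\times n_x}$ is the vertical stacking of $\Psi_0^0,\Psi_0^1,\dots,\Psi_0^{\mathrm{N}-1}$. The variational observability Gramian is $V_o(\mathcal{S}):=\Psi^\top\Psi=\sum_{k=0}^{\mathrm{N}-1}(\Phi_0^k)^\top\tilde C(\mathcal{S})^\top\tilde C(\mathcal{S})\Phi_0^k$. Modularity. A set function $f:2^{\mathcal{V}}\to\mathbb{R}$ is modular if there are a constant $w(\emptyset)\in\mathbb{R}$ and a weight function $w:\mathcal{V}\to\mathbb{R}$ such that $f(\mathcal{S})=w(\emptyset)+\sum_{s\in\mathcal{S}}w(s)$ for all $\mathcal{S}\subseteq\mathcal{V}$. *)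

theory Defs
  imports "HOL-Analysis.Analysis"
begin

text \<open>The first and second derivatives are maps into the Banach spaces of bounded linear
  operators, so continuity of the second derivative refers to the operator norm.\<close>

definition C2_on :: "('a::real_normed_vector \<Rightarrow> 'b::real_normed_vector) \<Rightarrow> 'a set \<Rightarrow> bool" where
  "C2_on f M \<longleftrightarrow>
     (\<exists>(f' :: 'a \<Rightarrow> 'a \<Rightarrow>\<^sub>L 'b) (f'' :: 'a \<Rightarrow> 'a \<Rightarrow>\<^sub>L ('a \<Rightarrow>\<^sub>L 'b)).
        (\<forall>x\<in>M. (f has_derivative blinfun_apply (f' x)) (at x)) \<and>
        (\<forall>x\<in>M. (f' has_derivative blinfun_apply (f'' x)) (at x)) \<and>
        continuous_on M f'')"

text \<open>The vector field \<open>f\<close> is a total function here; its values outside the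
  state space are irrelevant as long as trajectories remain inside.\<close>

primrec traj :: "(real^'n \<Rightarrow> real^'n) \<Rightarrow> real^'n \<Rightarrow> nat \<Rightarrow> real^'n" where
  "traj f x0 0 = x0"
| "traj f x0 (Suc k) = traj f x0 k + f (traj f x0 k)"

definition sensor_matrix :: "('m \<Rightarrow> real^'n) \<Rightarrow> 'm set \<Rightarrow> real^'n^'m" where
  "sensor_matrix c S = (\<chi> j. if j \<in> S then c j else 0)"

definition variational_map :: "(real^'n \<Rightarrow> real^'n) \<Rightarrow> real^'n \<Rightarrow> nat \<Rightarrow> real^'n^'n" where
  "variational_map f x0 k = jacobian (\<lambda>x. traj f x k) (at x0)"

definition obs_block ::
    "(real^'n \<Rightarrow> real^'n) \<Rightarrow> ('m \<Rightarrow> real^'n) \<Rightarrow> real^'n \<Rightarrow> 'm set \<Rightarrow> nat \<Rightarrow> real^'n^'m" where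
  "obs_block f c x0 S k = sensor_matrix c S ** variational_map f x0 k"

definition var_obs_gramian ::
    "(real^'n \<Rightarrow> real^'n) \<Rightarrow> ('m::finite \<Rightarrow> real^'n) \<Rightarrow> real^'n \<Rightarrow> nat \<Rightarrow> 'm set \<Rightarrow> real^'n^'n" where
  "var_obs_gramian f c x0 N S =
     (\<Sum>k<N. transpose (obs_block f c x0 S k) ** obs_block f c x0 S k)"

definition modular_on :: "'v set \<Rightarrow> ('v set \<Rightarrow> real) \<Rightarrow> bool" where
  "modular_on V f \<longleftrightarrow>
     (\<exists>(w0 :: real) (w :: 'v \<Rightarrow> real). \<forall>S\<subseteq>V. f S = w0 + (\<Sum>s\<in>S. w s))"

text \<open>The chain-rule recursion of the variational mapping.\<close>

lemma variational_map_0: "variational_map f x0 0 = mat 1"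
  by (simp add: variational_map_def jacobian_def matrix_id_mat_1[unfolded id_def])

lemma traj_differentiable:
  assumes "C2_on f M" and "\<And>i. traj f x0 i \<in> M"
  shows "(\<lambda>x. traj f x k) differentiable (at x0)"
proof (induction k)
  case 0
  show ?case by simp
next
  case (Suc k)
  have "f differentiable (at (traj f x0 k))"
    using assms unfolding C2_on_def differentiable_def by blast
  then have "(\<lambda>x. f (traj f x k)) differentiable (at x0)"
    using differentiable_chain_at[OF Suc.IH] by (simp add: o_def)
  with Suc.IH show ?case by simp
qed

lemma variational_map_Suc:
  assumes "C2_on f M" and "\<And>i. traj f x0 i \<in> M"
  shows "variational_map f x0 (Suc k) =
    (mat 1 + jacobian f (at (traj f x0 k))) ** variational_map f x0 k"
proof -
  let ?T = "\<lambda>x. traj f x k" and ?J = "jacobian f (at (traj f x0 k))"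
  let ?A = "variational_map f x0 k"
  have T: "(?T has_derivative (\<lambda>h. ?A *v h)) (at x0)"
    using traj_differentiable[OF assms] by (simp add: jacobian_works variational_map_def)
  have "f differentiable (at (traj f x0 k))"
    using assms unfolding C2_on_def differentiable_def by blast
  then have F: "(f has_derivative (\<lambda>h. ?J *v h)) (at (?T x0))"
    by (simp add: jacobian_works)
  have "((\<lambda>x. traj f x (Suc k)) has_derivative (\<lambda>h. ?A *v h + ?J *v (?A *v h))) (at x0)"
    using has_derivative_add[OF T has_derivative_compose[OF T F]] by simp
  also have "(\<lambda>h. ?A *v h + ?J *v (?A *v h)) = (\<lambda>h. ((mat 1 + ?J) ** ?A) *v h)"
    by (simp add: fun_eq_iff matrix_vector_mul_assoc[symmetric] matrix_vector_mult_add_rdistrib)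
  finally have "frechet_derivative (\<lambda>x. traj f x (Suc k)) (at x0) = (*v) ((mat 1 + ?J) ** ?A)"
    using frechet_derivative_at by metis
  then show ?thesis
    by (simp add: variational_map_def jacobian_def)
qed

text \<open>The sum of block products is the Gram matrix of the stacked blocks, whose rows are
  indexed by pairs of a time and a sensor.\<close>

lemma var_obs_gramian_stacked:
  "var_obs_gramian f c x0 N S $ a $ b =
     (\<Sum>(k, j) \<in> {..<N} \<times> UNIV. obs_block f c x0 S k $ j $ a * obs_block f c x0 S k $ j $ b)"
  by (simp add: var_obs_gramian_def matrix_matrix_mult_def transpose_def sum.cartesian_product)

end

theory Submission
  imports Defs
begin

text \<open>The trace of a Gram matrix is the sum of the squared norms of the rows of the stacked
  matrix. The row for time \<open>k\<close> and sensor \<open>j\<close> is \<open>c j\<close> times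
  the variational map if \<open>j\<close> is selected and zero otherwise
  (\<open>obs_block_nth\<close>), so the trace splits into one contribution per selected sensor,
  unaffected by the others (\<open>trace_var_obs_gramian\<close>).\<close>

lemma obs_block_nth:
  "obs_block f c x0 S k $ j = (if j \<in> S then c j v* variational_map f x0 k else 0)"
  by (simp add: obs_block_def sensor_matrix_def vec_eq_iff matrix_matrix_mult_def
      vector_matrix_mult_def mult.commute)

text \<open>On the right, \<open>S\<close> survives only as an index set, which is the shape
  modularity asks for.\<close>

lemma trace_var_obs_gramian:
  "trace (var_obs_gramian f c x0 N S) =
     (\<Sum>j\<in>S. \<Sum>k<N. (norm (c j v* variational_map f x0 k))\<^sup>2)"
proof -
  let ?B = "\<lambda>k j. obs_block f c x0 S k $ j"
  have "trace (var_obs_gramian f c x0 N S) =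
      (\<Sum>(k, j) \<in> {..<N} \<times> UNIV. \<Sum>a\<in>UNIV. ?B k j $ a * ?B k j $ a)"
    unfolding trace_def var_obs_gramian_stacked
    by (subst sum.swap) (simp add: case_prod_unfold)
  also have "\<dots> = (\<Sum>(k, j) \<in> {..<N} \<times> UNIV. (norm (?B k j))\<^sup>2)"
    by (simp add: power2_norm_eq_inner inner_vec_def)
  also have "\<dots> = (\<Sum>j\<in>UNIV. \<Sum>k<N. (norm (?B k j))\<^sup>2)"
    by (subst sum.swap) (simp add: sum.cartesian_product)
  also have "\<dots> = (\<Sum>j\<in>S. \<Sum>k<N. (norm (?B k j))\<^sup>2)"
    \<comment> \<open>Unselected sensors have zero rows.\<close>
    by (rule sum.mono_neutral_right) (auto simp: obs_block_nth)
  also have "\<dots> = (\<Sum>j\<in>S. \<Sum>k<N. (norm (c j v* variational_map f x0 k))\<^sup>2)"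
    by (simp add: obs_block_nth)
  finally show ?thesis .
qed

theorem corollary1:
  fixes M X X0 :: "(real^'n) set"
    and f :: "real^'n \<Rightarrow> real^'n"
    and c :: "'m::finite \<Rightarrow> real^'n"
    and x0 :: "real^'n"
    and N :: nat
  assumes "open M"
    and "C2_on f M"
    and "compact X" and "X \<subseteq> M" and "X0 \<subseteq> X"
    and "\<And>z k. z \<in> X0 \<Longrightarrow> traj f z k \<in> X"
    and "x0 \<in> X0"
    and "N \<ge> 1"
  shows "modular_on (UNIV :: 'm set) (\<lambda>S. trace (var_obs_gramian f c x0 N S))"
  unfolding modular_on_def trace_var_obs_gramian
  \<comment> \<open>The constant is 0, the trace for the empty selection; the weight of
    \<open>j\<close> is the trace for \<open>j\<close> selected alone.\<close>
  by (intro exI[of _ 0] exI[of _ "\<lambda>j. \<Sum>k<N. (norm (c j v* variational_map f x0 k))\<^sup>2"]) simp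

end
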